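(* Let $E, A_0\in\mathbb{R}^{n\times n}$ with $E$ invertible, $B\in\mathbb{R}^{n\times m}$, $C\in\mathbb{R}^{\ell\times n}$, $U,V\in\mathbb{R}^{n\times k}$, and let $\mathsf{p}=[p_1,\dots,p_k]^T$ with $p_i\in\mathbb{R}_+$ for $i=1,\dots,k$. Consider the structured transfer function $$\mathcal{H}(s;\mathsf{p})=C\bigl(sE-(A_0-U\,\mathrm{diag}(p_1,\dots,p_k)V^T)\bigr)^{-1}B .$$ Then, as an identity of rational matrix-valued functions of $s$, $$\mathcal{H}(s;\mathsf{p})=\mathcal{H}_1(s)-\mathcal{H}_2(s)D(\mathsf{p})\bigl[I+D(\mathsf{p})\mathcal{H}_3(s)D(\mathsf{p})\bigr]^{-1}D(\mathsf{p})\mathcal{H}_4(s),$$ where $D(\mathsf{p})=\mathrm{diag}(\sqrt{p_1},\dots,\sqrt{p_k})$ and $$\mathcal{H}_1(s)=C(sE-A_0)^{-1}B,\quad \mathcal{H}_2(s)=C(sE-A_0)^{-1}U,\quad \mathcal{H}_3(s)=V^T(sE-A_0)^{-1}U,\quad \mathcal{H}_4(s)=V^T(sE-A_0)^{-1}B.$$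
   Context: $\mathbb{R}_+$ denotes the nonnegative real numbers. $I$ is the $k\times k$ identity matrix and $s$ is the complex (Laplace) variable. *)

theory Defs
  imports "HOL-Analysis.Analysis" "HOL-Computational_Algebra.Polynomial_Factorial"
begin

definition diag :: "'a::zero ^ 'k \<Rightarrow> 'a ^ 'k ^ 'k" where
  "diag v = (\<chi> i j. if i = j then v $ i else 0)"

text \<open>
  The argument \<open>\<phi>\<close> embeds the real coefficients into the field that contains the
  Laplace variable \<open>s\<close>.  Two instances are used.  With \<open>\<phi> = ratc\<close> and \<open>s = rats\<close>,
  everything is a matrix over the field of rational functions in one indeterminate over
  the complex numbers.  With \<open>\<phi> = complex_of_real\<close> and \<open>s\<close> a complex number, everything
  is a complex matrix, namely the value at the point \<open>s\<close>.
\<close>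

definition pencil :: "(real \<Rightarrow> 'a::field) \<Rightarrow> 'a \<Rightarrow> real ^ 'n ^ 'n \<Rightarrow> real ^ 'n ^ 'n \<Rightarrow> 'a ^ 'n ^ 'n" where
  "pencil \<phi> s E A = (\<chi> i j. s * \<phi> (E $ i $ j)) - map_matrix \<phi> A"

text \<open>
  \<open>transfer \<phi> s E A L R\<close> is \<open>L (s E - A)\<^sup>-\<^sup>1 R\<close>.  Since \<^const>\<open>matrix_inv\<close> is unspecified on
  singular matrices, it is meaningful only if the pencil is invertible.
\<close>

definition transfer ::
  "(real \<Rightarrow> 'a::field) \<Rightarrow> 'a \<Rightarrow> real ^ 'n ^ 'n \<Rightarrow> real ^ 'n ^ 'n \<Rightarrow> real ^ 'n ^ 'l \<Rightarrow> real ^ 'm ^ 'n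
    \<Rightarrow> 'a ^ 'm ^ 'l" where
  "transfer \<phi> s E A L R = map_matrix \<phi> L ** matrix_inv (pencil \<phi> s E A) ** map_matrix \<phi> R"

definition structured_A ::
  "real ^ 'n ^ 'n \<Rightarrow> real ^ 'k ^ 'n \<Rightarrow> real ^ 'k ^ 'n \<Rightarrow> real ^ 'k \<Rightarrow> real ^ 'n ^ 'n" where
  "structured_A A0 U V p = A0 - U ** diag p ** transpose V"

definition structured_transfer ::
  "(real \<Rightarrow> 'a::field) \<Rightarrow> 'a \<Rightarrow> real ^ 'n ^ 'n \<Rightarrow> real ^ 'n ^ 'n \<Rightarrow> real ^ 'm ^ 'n \<Rightarrow> real ^ 'n ^ 'l
    \<Rightarrow> real ^ 'k ^ 'n \<Rightarrow> real ^ 'k ^ 'n \<Rightarrow> real ^ 'k \<Rightarrow> 'a ^ 'm ^ 'l" where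
  "structured_transfer \<phi> s E A0 B C U V p = transfer \<phi> s E (structured_A A0 U V p) C B"

definition Dmat :: "(real \<Rightarrow> 'a::field) \<Rightarrow> real ^ 'k \<Rightarrow> 'a ^ 'k ^ 'k" where
  "Dmat \<phi> p = map_matrix \<phi> (diag (\<chi> i. sqrt (p $ i)))"

definition ratc :: "real \<Rightarrow> complex poly fract" where
  "ratc x = to_fract [:complex_of_real x:]"

definition rats :: "complex poly fract" where
  "rats = to_fract [:0, 1:]"

end

theory Submission
  imports Defs
begin

text \<open>
  Put \<open>P = s E - A\<^sub>0\<close>, \<open>X = U D\<close> and \<open>Y = D V\<^sup>T\<close>.  Since the weights \<open>p\<^sub>i\<close> are nonnegative,
  \<open>diag p = D\<^sup>2\<close>, so the pencil of the structured system is \<open>P + X Y\<close>.  The formula for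
  \<open>\<H>(s; p)\<close> is then the Woodbury formula for the inverse of this sum, multiplied by \<open>C\<close> from
  the left and by \<open>B\<close> from the right (\<open>structured_transfer_eq\<close>).  The matrix
  \<open>I + D \<H>\<^sub>3 D = I + Y P\<^sup>-\<^sup>1 X\<close> is invertible whenever \<open>P\<close> and \<open>P + X Y\<close> are.  This algebra
  works over any field into which the real coefficients embed, so it yields the identity of
  rational functions and the identity of values at once.

  It remains to see that pencils \<open>s E - A\<close> with \<open>E\<close> invertible are generically invertible.
  For \<open>s \<noteq> 0\<close> one has \<open>det (s E - A) = s\<^sup>n det (E - s\<^sup>-\<^sup>1 A)\<close>, and \<open>det (E - t A)\<close> is a
  polynomial in \<open>t\<close> with the nonzero value \<open>det E\<close> at \<open>t = 0\<close>; it has finitely many zeros, so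
  only finitely many complex \<open>s\<close> make \<open>s E - A\<close> singular (\<open>finite_singular_points\<close>).  Hence the
  polynomial \<open>det (s E - A)\<close> is not the zero polynomial, and the pencil is invertible over the
  field of rational functions (\<open>invertible_rational_pencil\<close>).
\<close>

section \<open>Matrix algebra and the Woodbury formula\<close>

lemma matrix_add_rdistrib:
  fixes A B :: "'a::semiring_1 ^ 'n ^ 'm" and C :: "'a ^ 'l ^ 'n"
  shows "(A + B) ** C = A ** C + B ** C"
  by (simp add: matrix_matrix_mult_def vec_eq_iff distrib_right sum.distrib)

lemma matrix_diff_ldistrib:
  fixes A :: "'a::ring_1 ^ 'n ^ 'm" and B C :: "'a ^ 'l ^ 'n"
  shows "A ** (B - C) = A ** B - A ** C"
  by (simp add: matrix_matrix_mult_def vec_eq_iff right_diff_distrib sum_subtractf)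

lemma matrix_diff_rdistrib:
  fixes A B :: "'a::ring_1 ^ 'n ^ 'm" and C :: "'a ^ 'l ^ 'n"
  shows "(A - B) ** C = A ** C - B ** C"
  by (simp add: matrix_matrix_mult_def vec_eq_iff left_diff_distrib sum_subtractf)

lemma matrix_inv_cancel:
  fixes A :: "'a::semiring_1 ^ 'n ^ 'm"
  assumes "invertible A"
  shows "A ** matrix_inv A = mat 1" "matrix_inv A ** A = mat 1"
  using someI_ex[OF assms[unfolded invertible_def]] unfolding matrix_inv_def by auto

lemma matrix_inv_eqI:
  fixes A A' :: "'a::field ^ 'n ^ 'n"
  assumes "A ** A' = mat 1"
  shows "invertible A" "matrix_inv A = A'"
proof -
  show inv: "invertible A"
    using assms invertible_right_inverse by blast
  have "matrix_inv A = matrix_inv A ** (A ** A')"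
    by (simp add: assms)
  also have "\<dots> = A'"
    by (simp add: matrix_mul_assoc matrix_inv_cancel[OF inv])
  finally show "matrix_inv A = A'" .
qed

text \<open>
  With \<open>G = P\<^sup>-\<^sup>1\<close> and \<open>H = (P + X Y)\<^sup>-\<^sup>1\<close>, everything follows from the resolvent identities
  \<open>G - H = G X Y H = H X Y G\<close>; the first of them shows that \<open>I - Y H X\<close> inverts \<open>I + Y G X\<close>.
\<close>

lemma woodbury:
  fixes P :: "'a::field ^ 'n ^ 'n" and X :: "'a ^ 'k ^ 'n" and Y :: "'a ^ 'n ^ 'k"
  assumes P: "invertible P" and PXY: "invertible (P + X ** Y)"
  defines "W \<equiv> mat 1 + Y ** matrix_inv P ** X"
  shows "invertible W"
    and "matrix_inv (P + X ** Y) =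
      matrix_inv P - matrix_inv P ** X ** matrix_inv W ** Y ** matrix_inv P"
proof -
  define G where "G = matrix_inv P"
  define H where "H = matrix_inv (P + X ** Y)"
  note dist = matrix_add_ldistrib matrix_add_rdistrib matrix_diff_ldistrib matrix_diff_rdistrib
  have G: "P ** G = mat 1" "G ** P = mat 1"
    unfolding G_def by (rule matrix_inv_cancel[OF P])+
  have H: "(P + X ** Y) ** H = mat 1" "H ** (P + X ** Y) = mat 1"
    unfolding H_def by (rule matrix_inv_cancel[OF PXY])+
  have "G = G ** ((P + X ** Y) ** H)"
    by (simp add: H)
  also have "\<dots> = H + G ** X ** Y ** H"
    by (simp add: dist matrix_mul_assoc G)
  finally have GH: "G ** X ** Y ** H = G - H"
    by (metis add_diff_cancel_left')
  have "G = (H ** (P + X ** Y)) ** G"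
    by (simp add: H)
  also have "\<dots> = H ** (P ** G) + H ** X ** Y ** G"
    by (simp add: dist matrix_mul_assoc)
  finally have HG: "H ** X ** Y ** G = G - H"
    by (simp add: G eq_diff_eq add.commute)
  have "Y ** G ** X ** Y ** H ** X = Y ** (G ** X ** Y ** H) ** X"
    by (simp add: matrix_mul_assoc)
  also have "\<dots> = Y ** G ** X - Y ** H ** X"
    by (simp add: GH dist)
  finally have "W ** (mat 1 - Y ** H ** X) = mat 1"
    by (simp add: W_def G_def[symmetric] dist matrix_mul_assoc)
  note W = matrix_inv_eqI[OF this]
  show "invertible W"
    by (rule W)
  have "G ** X ** Y ** H ** X ** Y ** G = G ** X ** Y ** G - (G - H)"
    by (simp add: GH HG dist)
  then show "matrix_inv (P + X ** Y) =
      matrix_inv P - matrix_inv P ** X ** matrix_inv W ** Y ** matrix_inv P"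
    by (simp add: W(2) G_def[symmetric] H_def[symmetric] dist matrix_mul_assoc)
qed

section \<open>Ring homomorphisms acting on matrices\<close>

locale unital_ring_hom =
  fixes h :: "'a::comm_ring_1 \<Rightarrow> 'b::comm_ring_1"
  assumes hom_one: "h 1 = 1"
    and hom_add: "h (x + y) = h x + h y"
    and hom_mult: "h (x * y) = h x * h y"
begin

lemma hom_zero: "h 0 = 0"
  using hom_add[of 0 0] by simp

lemma hom_uminus: "h (- x) = - h x"
  using hom_add[of x "- x"] by (simp add: hom_zero eq_neg_iff_add_eq_0 add.commute)

lemma hom_diff: "h (x - y) = h x - h y"
  using hom_add[of x "- y"] by (simp add: hom_uminus)

lemma hom_sum: "h (sum f I) = (\<Sum>i\<in>I. h (f i))"
  by (induction I rule: infinite_finite_induct) (simp_all add: hom_zero hom_add)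

lemma hom_prod: "h (prod f I) = (\<Prod>i\<in>I. h (f i))"
  by (induction I rule: infinite_finite_induct) (simp_all add: hom_one hom_mult)

lemma map_matrix_diff: "map_matrix h (A - B) = map_matrix h A - map_matrix h B"
  by (simp add: vec_eq_iff hom_diff)

lemma map_matrix_mult: "map_matrix h (A ** B) = map_matrix h A ** map_matrix h B"
  by (simp add: vec_eq_iff matrix_matrix_mult_def hom_sum hom_mult)

lemma det_map_matrix: "det (map_matrix h A) = h (det A)"
proof -
  have "h (of_int (sign q)) = of_int (sign q)" for q :: "'c \<Rightarrow> 'c"
    by (simp add: sign_def hom_one hom_uminus)
  then show ?thesis
    by (simp add: det_def hom_sum hom_mult hom_prod)
qed

end

lemma unital_ring_hom_complex_of_real: "unital_ring_hom complex_of_real"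
  by unfold_locales simp_all

lemma unital_ring_hom_ratc: "unital_ring_hom ratc"
  by unfold_locales
    (simp_all add: ratc_def one_pCons[symmetric] to_fract_add[symmetric] to_fract_mult[symmetric]
      del: to_fract_add to_fract_mult)

lemma unital_ring_hom_to_fract: "unital_ring_hom (to_fract :: 'a::idom \<Rightarrow> 'a fract)"
  by unfold_locales simp_all

lemma unital_ring_hom_poly: "unital_ring_hom (\<lambda>q. poly q (x::'a::comm_ring_1))"
  by unfold_locales simp_all

section \<open>The structured transfer function as a low-rank update\<close>

text \<open>Nonnegativity of the weights enters through \<open>sqrt x * sqrt x = x\<close>.\<close>

lemma diag_sqrt_square:
  fixes p :: "real ^ 'k"
  assumes "\<And>i. p $ i \<ge> 0"
  shows "diag (\<chi> i. sqrt (p $ i)) ** diag (\<chi> i. sqrt (p $ i)) = diag p"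
  using assms
  by (auto simp: vec_eq_iff matrix_matrix_mult_def diag_def mult_delta_left)

lemma pencil_structured:
  fixes E A0 :: "real ^ 'n ^ 'n" and U V :: "real ^ 'k ^ 'n" and p :: "real ^ 'k"
    and \<phi> :: "real \<Rightarrow> 'f::field"
  assumes hom: "unital_ring_hom \<phi>" and p: "\<And>i. p $ i \<ge> 0"
  shows "pencil \<phi> s E (structured_A A0 U V p) =
    pencil \<phi> s E A0 + (map_matrix \<phi> U ** Dmat \<phi> p) ** (Dmat \<phi> p ** map_matrix \<phi> (transpose V))"
proof -
  interpret unital_ring_hom \<phi> by (rule hom)
  have "map_matrix \<phi> (diag p) = Dmat \<phi> p ** Dmat \<phi> p"
    unfolding Dmat_def by (simp add: map_matrix_mult[symmetric] diag_sqrt_square p)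
  then show ?thesis
    by (simp add: pencil_def structured_A_def map_matrix_diff map_matrix_mult matrix_mul_assoc)
qed

text \<open>
  The scalar field is arbitrary here, so that the field of rational functions and the complex
  numbers (pointwise evaluation) are both covered.
\<close>

lemma structured_transfer_eq:
  fixes E A0 :: "real ^ 'n ^ 'n" and B :: "real ^ 'm ^ 'n" and C :: "real ^ 'n ^ 'l"
    and U V :: "real ^ 'k ^ 'n" and p :: "real ^ 'k" and \<phi> :: "real \<Rightarrow> 'f::field"
  assumes hom: "unital_ring_hom \<phi>" and p: "\<And>i. p $ i \<ge> 0"
    and P: "invertible (pencil \<phi> s E A0)"
    and S: "invertible (pencil \<phi> s E (structured_A A0 U V p))"
  defines "W \<equiv> mat 1 + Dmat \<phi> p ** transfer \<phi> s E A0 (transpose V) U ** Dmat \<phi> p"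
  shows "invertible W"
    and "structured_transfer \<phi> s E A0 B C U V p =
      transfer \<phi> s E A0 C B
      - transfer \<phi> s E A0 C U ** Dmat \<phi> p ** matrix_inv W
        ** Dmat \<phi> p ** transfer \<phi> s E A0 (transpose V) B"
proof -
  define X where "X = map_matrix \<phi> U ** Dmat \<phi> p"
  define Y where "Y = Dmat \<phi> p ** map_matrix \<phi> (transpose V)"
  have pencil: "pencil \<phi> s E (structured_A A0 U V p) = pencil \<phi> s E A0 + X ** Y"
    unfolding X_def Y_def by (rule pencil_structured[OF hom p])
  have W: "W = mat 1 + Y ** matrix_inv (pencil \<phi> s E A0) ** X"
    by (simp add: W_def X_def Y_def transfer_def matrix_mul_assoc)
  note woodbury = woodbury[OF P S[unfolded pencil], folded W]
  show "invertible W"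
    by (rule woodbury)
  show "structured_transfer \<phi> s E A0 B C U V p =
      transfer \<phi> s E A0 C B
      - transfer \<phi> s E A0 C U ** Dmat \<phi> p ** matrix_inv W
        ** Dmat \<phi> p ** transfer \<phi> s E A0 (transpose V) B"
    unfolding structured_transfer_def transfer_def pencil woodbury(2)
    by (simp add: X_def Y_def matrix_diff_ldistrib matrix_diff_rdistrib matrix_mul_assoc)
qed

section \<open>Generic invertibility of pencils\<close>

text \<open>
  This is \<open>F + x G\<close>.  Both arguments are free so that its determinant represents the polynomial
  \<open>det (s E - A)\<close> in \<open>s\<close> as well as the reversed one, \<open>det (E - t A)\<close> in \<open>t\<close>.
\<close>

definition linear_poly_matrix :: "real ^ 'n ^ 'n \<Rightarrow> real ^ 'n ^ 'n \<Rightarrow> complex poly ^ 'n ^ 'n" where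
  "linear_poly_matrix F G = (\<chi> i j. [:complex_of_real (F $ i $ j), complex_of_real (G $ i $ j):])"

lemma poly_det_linear_poly_matrix:
  "poly (det (linear_poly_matrix F G)) x =
    det (\<chi> i j. complex_of_real (F $ i $ j) + x * complex_of_real (G $ i $ j))"
proof -
  interpret unital_ring_hom "\<lambda>q. poly q x" by (rule unital_ring_hom_poly)
  have "map_matrix (\<lambda>q. poly q x) (linear_poly_matrix F G) =
      (\<chi> i j. complex_of_real (F $ i $ j) + x * complex_of_real (G $ i $ j))"
    by (simp add: vec_eq_iff linear_poly_matrix_def)
  then show ?thesis
    by (simp flip: det_map_matrix)
qed

lemma det_complex_pencil:
  "det (pencil complex_of_real s E A) = poly (det (linear_poly_matrix (- A) E)) s"
  unfolding poly_det_linear_poly_matrix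
  by (rule arg_cong[where f = det]) (simp add: vec_eq_iff pencil_def)

lemma det_rational_pencil:
  "det (pencil ratc rats E A) = to_fract (det (linear_poly_matrix (- A) E))"
proof -
  interpret unital_ring_hom "to_fract :: complex poly \<Rightarrow> complex poly fract"
    by (rule unital_ring_hom_to_fract)
  have "pencil ratc rats E A = map_matrix to_fract (linear_poly_matrix (- A) E)"
    by (simp add: vec_eq_iff pencil_def linear_poly_matrix_def ratc_def rats_def
        to_fract_mult[symmetric] to_fract_diff[symmetric] del: to_fract_mult to_fract_diff)
  then show ?thesis
    by (simp add: det_map_matrix)
qed

lemma det_complex_pencil_reverse:
  fixes E A :: "real ^ 'n ^ 'n"
  assumes "s \<noteq> 0"
  shows "det (pencil complex_of_real s E A) =
    s ^ CARD('n) * poly (det (linear_poly_matrix E (- A))) (inverse s)"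
proof -
  let ?M = "\<chi> i j. complex_of_real (E $ i $ j) + inverse s * complex_of_real ((- A) $ i $ j)"
  have "pencil complex_of_real s E A = (\<chi> i. s *s ?M $ i)"
    using assms by (simp add: vec_eq_iff pencil_def field_simps)
  then show ?thesis
    by (simp only: det_rows_mul poly_det_linear_poly_matrix) simp
qed

text \<open>
  A nonzero singular point is the inverse of a zero of the polynomial \<open>det (E - t A)\<close>, whose value
  at \<open>t = 0\<close> is \<open>det E \<noteq> 0\<close>.
\<close>

lemma finite_singular_points:
  fixes E A :: "real ^ 'n ^ 'n"
  assumes "invertible E"
  shows "finite {s. \<not> invertible (pencil complex_of_real s E A)}"
proof -
  interpret unital_ring_hom complex_of_real by (rule unital_ring_hom_complex_of_real)
  define r where "r = det (linear_poly_matrix E (- A))"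
  have "poly r 0 = det (map_matrix complex_of_real E)"
    unfolding r_def poly_det_linear_poly_matrix
    by (rule arg_cong[where f = det]) (simp add: vec_eq_iff)
  also have "\<dots> \<noteq> 0"
    using assms by (simp add: det_map_matrix invertible_det_nz)
  finally have "r \<noteq> 0"
    by auto
  then have "finite (insert 0 (inverse ` {t. poly r t = 0}))"
    by (simp add: poly_roots_finite)
  moreover have "s \<in> insert 0 (inverse ` {t. poly r t = 0})"
    if "\<not> invertible (pencil complex_of_real s E A)" for s
  proof (cases "s = 0")
    case False
    then have "poly r (inverse s) = 0"
      using that by (simp add: invertible_det_nz det_complex_pencil_reverse r_def)
    then show ?thesis
      by (metis (mono_tags) image_eqI insertCI inverse_inverse_eq mem_Collect_eq)
  qed simp
  then have "{s. \<not> invertible (pencil complex_of_real s E A)} \<subseteq> insert 0 (inverse ` {t. poly r t = 0})"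
    by blast
  ultimately show ?thesis
    by (rule rev_finite_subset)
qed

text \<open>
  A singular pencil over the rational functions would have a determinant that vanishes at every
  complex point, against the finiteness of the set of singular points.
\<close>

lemma invertible_rational_pencil:
  fixes E A :: "real ^ 'n ^ 'n"
  assumes "invertible E"
  shows "invertible (pencil ratc rats E A)"
proof -
  obtain s where "invertible (pencil complex_of_real s E A)"
    using finite_singular_points[OF assms, of A] infinite_UNIV_char_0[where 'a = complex]
    by (metis (mono_tags, lifting) UNIV_eq_I mem_Collect_eq)
  then have "det (linear_poly_matrix (- A) E) \<noteq> 0"
    by (auto simp: invertible_det_nz det_complex_pencil)
  then show ?thesis
    by (simp add: invertible_det_nz det_rational_pencil)
qed

section \<open>The identity for the structured transfer function\<close>

theorem proposition1:
  fixes E A0 :: "real ^ 'n ^ 'n"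
    and B :: "real ^ 'm ^ 'n"
    and C :: "real ^ 'n ^ 'l"
    and U V :: "real ^ 'k ^ 'n"
    and p :: "real ^ 'k"
  assumes "invertible E"
    and "\<And>i. p $ i \<ge> 0"
  shows
    "\<comment> \<open>all the inverses exist over the field of rational functions\<close>
     invertible (pencil ratc rats E A0) \<and>
     invertible (pencil ratc rats E (structured_A A0 U V p)) \<and>
     invertible (mat 1 + Dmat ratc p ** transfer ratc rats E A0 (transpose V) U ** Dmat ratc p) \<and>
     \<comment> \<open>the identity of matrices of rational functions\<close>
     structured_transfer ratc rats E A0 B C U V p =
       transfer ratc rats E A0 C B
       - transfer ratc rats E A0 C U ** Dmat ratc p
         ** matrix_inv (mat 1 + Dmat ratc p ** transfer ratc rats E A0 (transpose V) U ** Dmat ratc p)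
         ** Dmat ratc p ** transfer ratc rats E A0 (transpose V) B \<and>
     \<comment> \<open>the identity of values at all complex points but the finitely many where a pencil is singular\<close>
     finite {s. \<not> (invertible (pencil complex_of_real s E A0) \<and>
                   invertible (pencil complex_of_real s E (structured_A A0 U V p)))} \<and>
     (\<forall>s. invertible (pencil complex_of_real s E A0) \<and>
          invertible (pencil complex_of_real s E (structured_A A0 U V p)) \<longrightarrow>
       invertible (mat 1 + Dmat complex_of_real p
         ** transfer complex_of_real s E A0 (transpose V) U ** Dmat complex_of_real p) \<and>
       structured_transfer complex_of_real s E A0 B C U V p =
         transfer complex_of_real s E A0 C B
         - transfer complex_of_real s E A0 C U ** Dmat complex_of_real p
           ** matrix_inv (mat 1 + Dmat complex_of_real p
                ** transfer complex_of_real s E A0 (transpose V) U ** Dmat complex_of_real p)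
           ** Dmat complex_of_real p ** transfer complex_of_real s E A0 (transpose V) B)"
proof -
  have generic: "invertible (pencil ratc rats E A)" for A
    by (rule invertible_rational_pencil[OF assms(1)])
  note rational = structured_transfer_eq[OF unital_ring_hom_ratc assms(2) generic generic]
  note pointwise = structured_transfer_eq[OF unital_ring_hom_complex_of_real assms(2)]
  have "{s. \<not> (invertible (pencil complex_of_real s E A0) \<and>
               invertible (pencil complex_of_real s E (structured_A A0 U V p)))} =
      {s. \<not> invertible (pencil complex_of_real s E A0)} \<union>
      {s. \<not> invertible (pencil complex_of_real s E (structured_A A0 U V p))}"
    by blast
  then have finite: "finite {s. \<not> (invertible (pencil complex_of_real s E A0) \<and>
               invertible (pencil complex_of_real s E (structured_A A0 U V p)))}"
    by (simp only: finite_Un finite_singular_points[OF assms(1)] simp_thms)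
  show ?thesis
    by (intro conjI allI impI;
        (rule generic rational finite | erule conjE, rule pointwise; assumption))
qed

end
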